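(* Let $G=(V,E)$ be a graph with at least one edge, let $t\ge 1$ be an integer, and let $L(G)$ be its line graph with adjacency matrix $A'$ and adjacency eigenvalues $\lambda'_1\ge\lambda'_2\ge\cdots\ge\lambda'_m$, where $m=|E|$. Let $p\in\mathbb{R}_t[x]$ and set $W'(p):=\max_{e\in E}(p(A'))_{ee}$ and $w'(p):=\min_{e\in E}(p(A'))_{ee}$. Then $$\chi'_t(G)\ \ge\ \frac{|E|}{\min\bigl\{\,|\{i: p(\lambda'_i)\ge w'(p)\}|,\ |\{i: p(\lambda'_i)\le W'(p)\}|\,\bigr\}}.$$
   Context: All graphs are finite, simple and undirected. The line graph $L(G)$ has vertex set $E$, two edges being adjacent iff they share an endpoint. The distance between two edges of $G$ is their distance in $L(G)$ (equivalently, the number of vertices in a shortest path between them; incident edges have distance $1$). A distance-$t$ edge-colouring assigns colours to the edges so that any two distinct edges at distance at most $t$ receive distinct colours; $\chi'_t(G)$ is the least number of colours in such a colouring (equivalently, the chromatic number of the $t$-th power $L(G)^t$). $\mathbb{R}_t[x]$ denotes the real polynomials of degree at most $t$. *)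

theory Defs
  imports
    Complex_Main
    "HOL-Library.Extended_Nat"
    "HOL-Library.Multiset"
    "HOL-Computational_Algebra.Polynomial"
    "Jordan_Normal_Form.Char_Poly"
begin

definition simple_graph :: "'a set \<Rightarrow> 'a set set \<Rightarrow> bool" where
  "simple_graph V E \<longleftrightarrow> finite V \<and> (\<forall>e\<in>E. e \<subseteq> V \<and> card e = 2)"

text \<open>The line graph of \<open>(V, E)\<close> is the graph \<open>(E, line_edges E)\<close>.\<close>

definition line_edges :: "'a set set \<Rightarrow> 'a set set set" where
  "line_edges E = {{e, f} | e f. e \<in> E \<and> f \<in> E \<and> e \<noteq> f \<and> e \<inter> f \<noteq> {}}"

text \<open>Paths are lists of vertices; a path given by \<open>xs\<close> has \<open>length xs - 1\<close> edges.\<close>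

definition is_path :: "'a set \<Rightarrow> 'a set set \<Rightarrow> 'a \<Rightarrow> 'a list \<Rightarrow> 'a \<Rightarrow> bool" where
  "is_path V E u xs v \<longleftrightarrow>
     xs \<noteq> [] \<and> hd xs = u \<and> last xs = v \<and> set xs \<subseteq> V \<and> distinct xs \<and>
     (\<forall>i. Suc i < length xs \<longrightarrow> {xs ! i, xs ! Suc i} \<in> E)"

text \<open>Vertices in different components are at distance \<open>\<infinity>\<close>, the infimum of the empty set.\<close>

definition graph_dist :: "'a set \<Rightarrow> 'a set set \<Rightarrow> 'a \<Rightarrow> 'a \<Rightarrow> enat" where
  "graph_dist V E u v = (INF xs \<in> {xs. is_path V E u xs v}. enat (length xs - 1))"

definition edge_dist :: "'a set set \<Rightarrow> 'a set \<Rightarrow> 'a set \<Rightarrow> enat" where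
  "edge_dist E e f = graph_dist E (line_edges E) e f"

definition distance_edge_colouring :: "'a set set \<Rightarrow> nat \<Rightarrow> ('a set \<Rightarrow> 'c) \<Rightarrow> bool" where
  "distance_edge_colouring E t c \<longleftrightarrow>
     (\<forall>e\<in>E. \<forall>f\<in>E. e \<noteq> f \<and> edge_dist E e f \<le> enat t \<longrightarrow> c e \<noteq> c f)"

definition distance_chromatic_index :: "'a set set \<Rightarrow> nat \<Rightarrow> nat" where
  "distance_chromatic_index E t =
     (LEAST k. \<exists>c :: 'a set \<Rightarrow> nat. c ` E \<subseteq> {..<k} \<and> distance_edge_colouring E t c)"

text \<open>The list \<open>vs\<close> enumerates the vertices of the graph and fixes the order of rows and columns.\<close>

definition adjacency_matrix :: "'a list \<Rightarrow> 'a set set \<Rightarrow> real mat" where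
  "adjacency_matrix vs E =
     mat (length vs) (length vs) (\<lambda>(i, j). if {vs ! i, vs ! j} \<in> E then 1 else 0)"

text \<open>
  The real eigenvalues, repeated according to algebraic multiplicity, in nonincreasing order.
  For a real symmetric matrix these are all the eigenvalues, so the list has length \<open>dim_row A\<close>.
\<close>

definition eigenvalue_list :: "real mat \<Rightarrow> real list" where
  "eigenvalue_list A = rev (sorted_list_of_multiset (proots (char_poly A)))"

definition poly_mat :: "real poly \<Rightarrow> real mat \<Rightarrow> real mat" where
  "poly_mat p A = mat (dim_row A) (dim_row A)
     (\<lambda>(i, j). \<Sum>k\<le>degree p. coeff p k * (A ^\<^sub>m k) $$ (i, j))"

definition max_diag :: "real mat \<Rightarrow> real" where
  "max_diag M = Max {M $$ (i, i) | i. i < dim_row M}"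

definition min_diag :: "real mat \<Rightarrow> real" where
  "min_diag M = Min {M $$ (i, i) | i. i < dim_row M}"

end

theory Submission
  imports Defs
begin

text \<open>
  A colour class \<open>S\<close> consists of edges at pairwise distance greater than \<open>t\<close>, and entries of powers of
  \<open>A'\<close> count walks, so the principal submatrix of \<open>p(A')\<close> on \<open>S\<close> is diagonal with entries in
  \<open>[w', W']\<close>. By interlacing, \<open>p(A')\<close> has at least \<open>|S|\<close> eigenvalues \<open>\<ge> w'\<close> and at least
  \<open>|S|\<close> eigenvalues \<open>\<le> W'\<close>. This bounds every colour class, hence the number of colours.
\<close>

section \<open>Spectral theorem for real symmetric matrices\<close>

text \<open>Over the complex numbers the characteristic polynomial splits, so some eigenvalue
  exists. Symmetry makes it real, hence a root of the real characteristic polynomial, and a real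
  eigenvector can be normalised.\<close>

lemma real_symmetric_eigenvector:
  fixes A :: "real mat"
  assumes A: "A \<in> carrier_mat n n" and sym: "A\<^sup>T = A" and n: "n > 0"
  obtains k v where "v \<in> carrier_vec n" "v \<bullet> v = 1" "A *\<^sub>v v = k \<cdot>\<^sub>v v"
proof -
  let ?C = "map_mat complex_of_real A"
  have C: "?C \<in> carrier_mat n n" using A by simp
  obtain as where as: "char_poly ?C = (\<Prod>a\<leftarrow>as. [:- a, 1:])" "length as = n"
    using char_poly_factorized[OF C] by blast
  define z where "z = hd as"
  have "z \<in> set as" unfolding z_def using as(2) n by (cases as) auto
  then have root: "poly (char_poly ?C) z = 0"
    unfolding as(1) by (induction as) auto
  then obtain u where u: "u \<in> carrier_vec n" "u \<noteq> 0\<^sub>v n" "?C *\<^sub>v u = z \<cdot>\<^sub>v u"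
    using eigenvalue_root_char_poly[OF C, of z] A unfolding eigenvalue_def eigenvector_def by auto
  have a_sym: "A $$ (i, j) = A $$ (j, i)" if "i < n" "j < n" for i j
    using sym A that by (metis carrier_matD index_transpose_mat(1))
  \<comment> \<open>For a complex eigenvector \<open>u\<close>, \<open>s\<close> is its squared norm
    and \<open>q\<close> the Hermitian form of \<open>A\<close> at \<open>u\<close>. Both are real,
    \<open>s\<close> is nonzero and \<open>q = z * s\<close>, which forces \<open>z\<close> to be
    real.\<close>
  define s where "s = (\<Sum>i<n. cnj (u $ i) * u $ i)"
  define q where "q = (\<Sum>i<n. \<Sum>j<n. cnj (u $ i) * A $$ (i, j) * u $ j)"
  have row: "(\<Sum>j<n. complex_of_real (A $$ (i, j)) * u $ j) = z * u $ i" if "i < n" for i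
  proof -
    have "(?C *\<^sub>v u) $ i = (z \<cdot>\<^sub>v u) $ i" using u by simp
    then show ?thesis using that A u(1) by (simp add: scalar_prod_def atLeast0LessThan)
  qed
  have "q = (\<Sum>i<n. cnj (u $ i) * (\<Sum>j<n. complex_of_real (A $$ (i, j)) * u $ j))"
    unfolding q_def by (simp add: sum_distrib_left mult.assoc)
  also have "\<dots> = (\<Sum>i<n. cnj (u $ i) * (z * u $ i))"
    by (simp add: row)
  also have "\<dots> = z * s"
    unfolding s_def by (simp add: sum_distrib_left mult_ac)
  finally have qz: "q = z * s" .
  have "cnj q = (\<Sum>i<n. \<Sum>j<n. cnj (u $ j) * A $$ (i, j) * u $ i)"
    unfolding q_def by (simp add: mult_ac)
  also have "\<dots> = (\<Sum>j<n. \<Sum>i<n. cnj (u $ j) * A $$ (i, j) * u $ i)"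
    by (rule sum.swap)
  also have "\<dots> = q"
    unfolding q_def by (intro sum.cong refl) (simp add: a_sym)
  finally have q_real: "cnj q = q" .
  have s_eq: "s = complex_of_real (\<Sum>i<n. (cmod (u $ i))\<^sup>2)"
    unfolding s_def of_real_sum complex_norm_square by (simp add: mult.commute)
  have "\<exists>i<n. u $ i \<noteq> 0"
    using u(1,2) by (metis carrier_vecD eq_vecI index_zero_vec)
  then have "(\<Sum>i<n. (cmod (u $ i))\<^sup>2) > 0"
    by (auto intro!: sum_pos2)
  then have "s \<noteq> 0" unfolding s_eq by (simp only: of_real_eq_0_iff)
  moreover have "cnj s = s" unfolding s_eq by simp
  ultimately have "cnj z = z"
    using q_real unfolding qz by simp
  then have z: "z = complex_of_real (Re z)"
    by (metis Reals_cnj_iff of_real_Re)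
  \<comment> \<open>Returning to the characteristic polynomial yields a fresh real eigenvector
    \<open>w\<close>, so \<open>u\<close> need not be split into real and imaginary parts.\<close>
  have "poly (map_poly complex_of_real (char_poly A)) (complex_of_real (Re z)) = 0"
    using root z of_real_hom.char_poly_hom[OF A, where 'a = complex] by simp
  then have "poly (char_poly A) (Re z) = 0"
    by simp
  then obtain w where w: "w \<in> carrier_vec n" "w \<noteq> 0\<^sub>v n" "A *\<^sub>v w = Re z \<cdot>\<^sub>v w"
    using eigenvalue_root_char_poly[OF A] A unfolding eigenvalue_def eigenvector_def by auto
  have "\<exists>i<n. w $ i \<noteq> 0"
    using w(1,2) by (metis carrier_vecD eq_vecI index_zero_vec)
  then have pos: "w \<bullet> w > 0"
    using w(1) by (auto simp: scalar_prod_def power2_eq_square[symmetric] intro!: sum_pos2)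
  define c where "c = 1 / sqrt (w \<bullet> w)"
  have "c * c * (w \<bullet> w) = 1"
    unfolding c_def using pos by (simp add: real_sqrt_mult[symmetric])
  then have "(c \<cdot>\<^sub>v w) \<bullet> (c \<cdot>\<^sub>v w) = 1"
    using w(1) by (simp add: mult.assoc)
  moreover have "A *\<^sub>v (c \<cdot>\<^sub>v w) = Re z \<cdot>\<^sub>v (c \<cdot>\<^sub>v w)"
    using w A by (simp add: mult_mat_vec smult_smult_assoc mult.commute)
  ultimately show ?thesis
    using that[of "c \<cdot>\<^sub>v w" "Re z"] w(1) by simp
qed

text \<open>The witness is the Householder reflection that exchanges \<open>v\<close> and the first unit vector.\<close>

lemma orthogonal_matrix_with_first_column:
  fixes v :: "real vec"
  assumes v: "v \<in> carrier_vec n" and unit: "v \<bullet> v = 1"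
  obtains H where "H \<in> carrier_mat n n" "H\<^sup>T = H" "H * H = 1\<^sub>m n" "col H 0 = v"
proof -
  have n: "n > 0" using unit v by (cases n) (auto simp: scalar_prod_def)
  \<comment> \<open>The vector \<open>u\<close> is \<open>v\<close> minus the first unit vector, a
    normal of the mirror, and \<open>r\<close> is its squared length. If \<open>v\<close> is already
    the first unit vector, then \<open>r = 0\<close>, so \<open>c = 2 / 0 = 0\<close> and
    \<open>H\<close> is the identity.\<close>
  define u where "u = (\<lambda>i. v $ i - (if i = 0 then 1 else 0))"
  define r where "r = (\<Sum>i<n. u i * u i)"
  define c where "c = 2 / r"
  define H where "H = mat n n (\<lambda>(i, j). (if i = j then 1 else 0) - c * u i * u j)"
  have vv: "(\<Sum>i<n. v $ i * v $ i) = 1"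
    using unit v by (simp add: scalar_prod_def atLeast0LessThan)
  have "r = (\<Sum>i<n. v $ i * v $ i) - 2 * (\<Sum>i<n. if i = 0 then v $ i else 0)
      + (\<Sum>i<n. if i = 0 then 1 else 0)"
    unfolding r_def u_def sum_distrib_left sum_subtractf[symmetric] sum.distrib[symmetric]
    by (intro sum.cong) (auto simp: algebra_simps)
  also have "\<dots> = 2 - 2 * v $ 0" using n by (simp add: vv)
  \<comment> \<open>This is where \<open>v\<close> being a unit vector enters. For nonzero
    \<open>r\<close> it gives \<open>c * u 0 = - 1\<close>, exactly what turns column 0 of
    \<open>H\<close> into \<open>v\<close>.\<close>
  finally have r: "r = - 2 * u 0" unfolding u_def by simp
  have crc: "c * c * r = 2 * c" unfolding c_def by simp
  have "H * H = 1\<^sub>m n"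
  proof (rule eq_matI)
    fix i j assume ij: "i < dim_row (1\<^sub>m n :: real mat)" "j < dim_col (1\<^sub>m n :: real mat)"
    let ?d = "\<lambda>i j. if i = j then 1 else 0 :: real"
    have "(H * H) $$ (i, j) = (\<Sum>k<n. (?d i k - c * u i * u k) * (?d k j - c * u k * u j))"
      using ij by (simp add: H_def scalar_prod_def atLeast0LessThan)
    also have "\<dots> = (\<Sum>k<n. if k = i then ?d i j - c * u i * u j else 0)
        - (\<Sum>k<n. if k = j then c * u i * u j else 0) + c * c * u i * u j * r"
      unfolding r_def sum_distrib_left sum_subtractf[symmetric] sum.distrib[symmetric]
      by (intro sum.cong) (auto simp: algebra_simps)
    also have "\<dots> = ?d i j + (c * c * r - 2 * c) * (u i * u j)"
      using ij by (simp add: algebra_simps)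
    finally show "(H * H) $$ (i, j) = 1\<^sub>m n $$ (i, j)"
      using ij by (simp add: crc)
  qed (simp_all add: H_def)
  moreover have "col H 0 = v"
  proof (rule eq_vecI)
    fix i assume "i < dim_vec v"
    then have i: "i < n" using v by simp
    have "c * u i * u 0 = - u i"
    proof (cases "r = 0")
      case True
      then have "\<forall>i<n. u i * u i = 0"
        unfolding r_def by (subst (asm) sum_nonneg_eq_0_iff) auto
      then show ?thesis using i by simp
    next
      case False
      then have "c * u 0 = - 1" unfolding c_def r by (auto simp: field_simps)
      then show ?thesis by (metis mult.commute mult.left_commute mult_minus1)
    qed
    then show "col H 0 $ i = v $ i" using i n by (simp add: H_def u_def)
  qed (use v in \<open>simp add: H_def\<close>)
  moreover have "H\<^sup>T = H" by (rule eq_matI) (auto simp: H_def)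
  ultimately show ?thesis using that[of H] by (simp add: H_def)
qed

text \<open>Deflation: a reflection moves a unit eigenvector to the first coordinate, symmetry then
  splits off a 1 by 1 block, and induction treats the rest. Orthogonality is contained in the
  witness pair, since \<open>P\<close> and \<open>P\<^sup>T\<close> are mutually inverse.\<close>

theorem real_symmetric_orthogonally_diagonalizable:
  fixes A :: "real mat"
  assumes "A \<in> carrier_mat n n" and "A\<^sup>T = A"
  shows "\<exists>P d. similar_mat_wit A (mat_diag n d) P P\<^sup>T"
  using assms
proof (induction n arbitrary: A)
  case 0
  have "similar_mat_wit A (mat_diag 0 (\<lambda>_. 0)) (1\<^sub>m 0) (1\<^sub>m 0)\<^sup>T"
    by (rule similar_mat_witI[where n = 0]) (use 0 in \<open>auto intro!: eq_matI\<close>)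
  then show ?case by blast
next
  case (Suc n)
  note A = Suc.prems(1)
  obtain k v where v: "v \<in> carrier_vec (Suc n)" "v \<bullet> v = 1" "A *\<^sub>v v = k \<cdot>\<^sub>v v"
    using real_symmetric_eigenvector[OF Suc.prems zero_less_Suc] by blast
  obtain H where H: "H \<in> carrier_mat (Suc n) (Suc n)" "H\<^sup>T = H" "H * H = 1\<^sub>m (Suc n)" "col H 0 = v"
    using orthogonal_matrix_with_first_column[OF v(1,2)] by blast
  define B where "B = H * A * H"
  have B: "B \<in> carrier_mat (Suc n) (Suc n)" using A H(1) by (simp add: B_def)
  have "B\<^sup>T = H\<^sup>T * (H * A)\<^sup>T"
    unfolding B_def by (rule transpose_mult) (use A H(1) in auto)
  also have "(H * A)\<^sup>T = A\<^sup>T * H\<^sup>T"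
    by (rule transpose_mult) (use A H(1) in auto)
  finally have B_sym: "B\<^sup>T = B"
    unfolding B_def H(2) Suc.prems(2) using A H(1) by simp
  \<comment> \<open>As \<open>v\<close> is the first column of the involution \<open>H\<close>,
    applying \<open>H\<close> to \<open>v\<close> returns the first unit vector; column 0 of
    \<open>B\<close> is therefore \<open>k\<close> times that vector.\<close>
  have "col B 0 = H * A *\<^sub>v v"
    unfolding B_def H(4)[symmetric] by (rule col_mult2) (use A H(1) in auto)
  also have "\<dots> = H *\<^sub>v (k \<cdot>\<^sub>v v)"
    using A H(1) v by (simp add: assoc_mult_mat_vec)
  also have "\<dots> = k \<cdot>\<^sub>v (H *\<^sub>v v)"
    using H(1) v(1) by (rule mult_mat_vec)
  also have "H *\<^sub>v v = col (H * H) 0"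
    unfolding H(4)[symmetric] by (rule col_mult2[symmetric]) (use H(1) in auto)
  finally have col: "col B 0 = k \<cdot>\<^sub>v unit_vec (Suc n) 0"
    unfolding H(3) by simp
  have B_col: "B $$ (i, 0) = (if i = 0 then k else 0)" if "i < Suc n" for i
    using arg_cong[OF col, of "\<lambda>x. x $ i"] that B by auto
  have B_row: "B $$ (0, i) = (if i = 0 then k else 0)" if "i < Suc n" for i
    using B_col[OF that] B_sym B that by (metis carrier_matD index_transpose_mat(1) zero_less_Suc)
  define C where "C = mat n n (\<lambda>(i, j). B $$ (Suc i, Suc j))"
  have C: "C \<in> carrier_mat n n" by (simp add: C_def)
  have "C\<^sup>T = C"
  proof (rule eq_matI)
    fix i j assume "i < dim_row C" "j < dim_col C"
    then show "C\<^sup>T $$ (i, j) = C $$ (i, j)"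
      using B_sym B by (simp add: C_def) (metis Suc_less_eq carrier_matD index_transpose_mat(1))
  qed (simp_all add: C_def)
  then obtain Q d where Q: "similar_mat_wit C (mat_diag n d) Q Q\<^sup>T"
    using Suc.IH[OF C] by blast
  have Qc: "Q \<in> carrier_mat n n" using similar_mat_witD2[OF C Q] by simp
  let ?K = "mat_diag 1 (\<lambda>_. k)"
  define F where "F = four_block_mat (1\<^sub>m 1) (0\<^sub>m 1 n) (0\<^sub>m n 1) Q"
  have F: "F \<in> carrier_mat (Suc n) (Suc n)" using Qc by (auto simp: F_def)
  have FT: "F\<^sup>T = four_block_mat (1\<^sub>m 1) (0\<^sub>m 1 n) (0\<^sub>m n 1) Q\<^sup>T"
    unfolding F_def by (subst transpose_four_block_mat) (use Qc in auto)
  have B_block: "B = four_block_mat ?K (0\<^sub>m 1 n) (0\<^sub>m n 1) C"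
    by (rule eq_matI) (use B in \<open>auto simp: B_row B_col C_def mat_diag_def\<close>)
  \<comment> \<open>\<open>case_nat k d\<close> puts \<open>k\<close> in front of the diagonal
    \<open>d\<close>.\<close>
  have D_block: "mat_diag (Suc n) (case_nat k d) =
      four_block_mat ?K (0\<^sub>m 1 n) (0\<^sub>m n 1) (mat_diag n d)"
    by (rule eq_matI) (auto simp: mat_diag_def split: nat.split)
  have K: "similar_mat_wit ?K ?K (1\<^sub>m 1) (1\<^sub>m 1)"
    by (rule similar_mat_wit_refl) (rule mat_diag_dim)
  have BD: "similar_mat_wit B (mat_diag (Suc n) (case_nat k d)) F F\<^sup>T"
    unfolding B_block D_block FT unfolding F_def
    by (rule similar_mat_wit_four_block[OF K Q]) (use Qc C in auto)
  have "similar_mat_wit B A H H"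
    by (rule similar_mat_witI[OF H(3) H(3)]) (use A B H(1) in \<open>auto simp: B_def\<close>)
  then have "similar_mat_wit A B H H" by (rule similar_mat_wit_sym)
  from similar_mat_wit_trans[OF this BD]
  have "similar_mat_wit A (mat_diag (Suc n) (case_nat k d)) (H * F) (F\<^sup>T * H)" .
  also have "F\<^sup>T * H = (H * F)\<^sup>T"
    using transpose_mult[OF H(1) F] H(2) by simp
  finally show ?case by blast
qed

section \<open>Polynomials and eigenvalue counts of a diagonalised matrix\<close>

lemma mat_diag_pow: "mat_diag n d ^\<^sub>m k = mat_diag n (\<lambda>i. d i ^ k)"
  by (induction k) (simp_all add: power_commutes carrier_matD(1)[OF mat_diag_dim])

text \<open>Powers pass through the similarity and act on the diagonal alone; summing them against
  the coefficients of \<open>p\<close> and exchanging sums assembles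
  \<open>poly p (d l)\<close>.\<close>

lemma poly_mat_index_of_diagonalization:
  assumes A: "A \<in> carrier_mat n n" and sim: "similar_mat_wit A (mat_diag n d) P P\<^sup>T"
    and i: "i < n" and j: "j < n"
  shows "poly_mat p A $$ (i, j) = (\<Sum>l<n. P $$ (i, l) * poly p (d l) * P $$ (j, l))"
proof -
  have P: "P \<in> carrier_mat n n" using similar_mat_witD2[OF A sim] by simp
  have pow: "(A ^\<^sub>m k) $$ (i, j) = (\<Sum>l<n. P $$ (i, l) * d l ^ k * P $$ (j, l))" for k
    unfolding similar_mat_wit_pow_id[OF sim] mat_diag_pow mat_diag_mult_right[OF P]
    using P i j by (simp add: scalar_prod_def atLeast0LessThan)
  have "poly_mat p A $$ (i, j) =
      (\<Sum>k\<le>degree p. \<Sum>l<n. coeff p k * (P $$ (i, l) * d l ^ k * P $$ (j, l)))"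
    using A i j by (simp add: poly_mat_def pow sum_distrib_left)
  also have "\<dots> = (\<Sum>l<n. \<Sum>k\<le>degree p. coeff p k * (P $$ (i, l) * d l ^ k * P $$ (j, l)))"
    by (rule sum.swap)
  also have "\<dots> = (\<Sum>l<n. P $$ (i, l) * poly p (d l) * P $$ (j, l))"
    by (simp add: poly_altdef sum_distrib_left sum_distrib_right mult_ac)
  finally show ?thesis .
qed

text \<open>Similar matrices share their characteristic polynomial, and that of a diagonal matrix is
  a product of linear factors whose roots can be read off with multiplicity.\<close>

lemma mset_eigenvalue_list_of_diagonalization:
  assumes A: "A \<in> carrier_mat n n" and sim: "similar_mat_wit A (mat_diag n d) P Q"
  shows "mset (eigenvalue_list A) = mset (map d [0..<n])"
proof -
  have "char_poly A = char_poly (mat_diag n d)"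
    using sim by (intro char_poly_similar) (auto simp: similar_mat_def)
  also have "\<dots> = (\<Prod>a\<leftarrow>diag_mat (mat_diag n d). [:- a, 1:])"
    by (rule char_poly_upper_triangular[where n = n]) (auto simp: mat_diag_def upper_triangular_def)
  also have "diag_mat (mat_diag n d) = map d [0..<n]"
    by (auto simp: diag_mat_def mat_diag_def)
  finally have cp: "char_poly A = (\<Prod>a\<leftarrow>map d [0..<n]. [:- a, 1:])" .
  have "proots (\<Prod>a\<leftarrow>as. [:- a, 1:]) = mset as" for as :: "real list"
  proof (induction as)
    case (Cons a as)
    moreover have "(\<Prod>a\<leftarrow>as. [:- a, 1:]) \<noteq> 0"
      by auto
    ultimately show ?case by (simp add: proots_mult del: mult_pCons_left)
  qed simp
  then show ?thesis by (simp only: eigenvalue_list_def cp mset_rev mset_sorted_list_of_multiset)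
qed

text \<open>A count depends only on the multiset, so the sorted eigenvalues, indexed from 1, may be
  exchanged for the unsorted \<open>d\<close>, indexed from 0.\<close>

lemma card_eigenvalue_list_indices:
  assumes A: "A \<in> carrier_mat n n" and sim: "similar_mat_wit A (mat_diag n d) P Q"
  shows "card {i \<in> {1..n}. R (eigenvalue_list A ! (i - 1))} = card {l \<in> {..<n}. R (d l)}"
proof -
  note ms = mset_eigenvalue_list_of_diagonalization[OF A sim]
  have len: "length (eigenvalue_list A) = n"
    using arg_cong[OF ms, of size] by simp
  have "{i \<in> {1..n}. R (eigenvalue_list A ! (i - 1))} = Suc ` {i. i < n \<and> R (eigenvalue_list A ! i)}"
    by (auto simp: image_iff gr0_conv_Suc Suc_le_eq)
  then have "card {i \<in> {1..n}. R (eigenvalue_list A ! (i - 1))} = length (filter R (eigenvalue_list A))"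
    by (simp add: card_image length_filter_conv_card len)
  also have "\<dots> = length (filter R (map d [0..<n]))"
    using ms by (metis mset_filter size_mset)
  also have "\<dots> = card {l \<in> {..<n}. R (d l)}"
    by (auto simp: length_filter_conv_card intro!: arg_cong[where f = card])
  finally show ?thesis .
qed

section \<open>Interlacing bound for diagonal principal blocks\<close>

text \<open>With fewer equations than unknowns, the coefficient matrix can be padded to a square one
  with a zero row. Its determinant vanishes, so it has a nonzero kernel vector.\<close>

lemma underdetermined_homogeneous_system:
  fixes a :: "'i \<Rightarrow> 'j \<Rightarrow> 'b :: field"
  assumes I: "finite I" and J: "finite J" and less: "card I < card J"
  obtains x j where "j \<in> J" "x j \<noteq> 0" "\<And>i. i \<in> I \<Longrightarrow> (\<Sum>j\<in>J. a i j * x j) = 0"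
proof -
  obtain f where f: "bij_betw f {..<card I} I"
    using ex_bij_betw_nat_finite[OF I] by (auto simp: atLeast0LessThan)
  obtain g where g: "bij_betw g {..<card J} J"
    using ex_bij_betw_nat_finite[OF J] by (auto simp: atLeast0LessThan)
  define m where "m = card J"
  \<comment> \<open>Rows below \<open>card I\<close> hold the equations, and row
    \<open>card I\<close> is the zero row; any rows after it may be arbitrary.\<close>
  define M where "M = mat\<^sub>r m m (\<lambda>r. if r = card I then 0\<^sub>v m else vec m (\<lambda>s. a (f r) (g s)))"
  have "det M = 0"
    unfolding M_def by (rule det_row_0) (use less in \<open>auto simp: m_def\<close>)
  moreover have "M \<in> carrier_mat m m" by (simp add: M_def)
  ultimately obtain y where y: "y \<in> carrier_vec m" "y \<noteq> 0\<^sub>v m" "M *\<^sub>v y = 0\<^sub>v m"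
    using det_0_iff_vec_prod_zero by blast
  define x where "x = (\<lambda>j. y $ inv_into {..<m} g j)"
  have xg: "x (g s) = y $ s" if "s < m" for s
    using g that by (simp add: x_def m_def bij_betw_def)
  obtain s where s: "s < m" "y $ s \<noteq> 0"
    using y(1,2) by (metis carrier_vecD eq_vecI index_zero_vec)
  have "(\<Sum>j\<in>J. a i j * x j) = 0" if i: "i \<in> I" for i
  proof -
    have "i \<in> f ` {..<card I}" using f i by (simp add: bij_betw_def)
    then obtain r where r: "r < card I" "f r = i" by auto
    have "(\<Sum>j\<in>J. a i j * x j) = (\<Sum>s<m. a i (g s) * x (g s))"
      using sum.reindex_bij_betw[OF g, of "\<lambda>j. a i j * x j"] by (simp add: m_def)
    also have "\<dots> = (M *\<^sub>v y) $ r"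
      using r less y(1) by (simp add: M_def m_def[symmetric] scalar_prod_def xg atLeast0LessThan)
    also have "\<dots> = 0" using y(3) r less by (simp add: m_def)
    finally show ?thesis .
  qed
  moreover have "g s \<in> J" using g s by (auto simp: bij_betw_def m_def)
  ultimately show ?thesis using that[of "g s" x] s by (simp add: xg)
qed

text \<open>
  If \<open>S\<close> were larger than the set of \<open>l\<close> with \<open>q l \<ge> w\<close>, some nonzero vector supported on \<open>S\<close>
  would be orthogonal to the corresponding eigenvectors; its Rayleigh quotient would be both
  less than \<open>w\<close> and, by diagonality on \<open>S\<close>, at least \<open>w\<close>.
\<close>

lemma card_diagonal_block_le_card_large_eigenvalues:
  fixes P :: "nat \<Rightarrow> nat \<Rightarrow> real" and q :: "nat \<Rightarrow> real"
  assumes orth: "\<And>i j. i < n \<Longrightarrow> j < n \<Longrightarrow> (\<Sum>l<n. P i l * P j l) = (if i = j then 1 else 0)"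
    and S: "S \<subseteq> {..<n}"
    and off: "\<And>i j. i \<in> S \<Longrightarrow> j \<in> S \<Longrightarrow> i \<noteq> j \<Longrightarrow> (\<Sum>l<n. P i l * q l * P j l) = 0"
    and diag: "\<And>i. i \<in> S \<Longrightarrow> w \<le> (\<Sum>l<n. P i l * q l * P i l)"
  shows "card S \<le> card {l \<in> {..<n}. q l \<ge> w}"
proof (rule ccontr)
  assume "\<not> card S \<le> card {l \<in> {..<n}. q l \<ge> w}"
  then have less: "card {l \<in> {..<n}. q l \<ge> w} < card S" by simp
  have fin: "finite S" using S finite_subset by blast
  have finI: "finite {l \<in> {..<n}. q l \<ge> w}" by simp
  obtain x j where x: "j \<in> S" "x j \<noteq> 0"
    and zero: "\<And>l. l \<in> {l \<in> {..<n}. q l \<ge> w} \<Longrightarrow> (\<Sum>i\<in>S. P i l * x i) = 0"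
    using underdetermined_homogeneous_system[OF finI fin less, of "\<lambda>l i. P i l"] by blast
  \<comment> \<open>\<open>y\<close> lists the coordinates, in the eigenbasis formed by the columns
    of \<open>P\<close>, of the vector \<open>x\<close> supported on \<open>S\<close>.\<close>
  define y where "y = (\<lambda>l. \<Sum>i\<in>S. P i l * x i)"
  \<comment> \<open>Stated for general weights \<open>c\<close> because it is used twice:
    \<open>c = 1\<close> compares the norms of \<open>x\<close> and \<open>y\<close>, and
    \<open>c = q\<close> expresses the quadratic form.\<close>
  have quad: "(\<Sum>l<n. c l * (y l)\<^sup>2) = (\<Sum>i\<in>S. \<Sum>j\<in>S. x i * x j * (\<Sum>l<n. P i l * c l * P j l))"
    for c :: "nat \<Rightarrow> real"
  proof -
    have "(\<Sum>l<n. c l * (y l)\<^sup>2) = (\<Sum>l<n. \<Sum>i\<in>S. \<Sum>j\<in>S. x i * x j * (P i l * c l * P j l))"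
      unfolding y_def power2_eq_square sum_product
      by (simp add: sum_distrib_left mult_ac)
    also have "\<dots> = (\<Sum>i\<in>S. \<Sum>l<n. \<Sum>j\<in>S. x i * x j * (P i l * c l * P j l))"
      by (rule sum.swap)
    also have "\<dots> = (\<Sum>i\<in>S. \<Sum>j\<in>S. \<Sum>l<n. x i * x j * (P i l * c l * P j l))"
      by (intro sum.cong refl sum.swap)
    finally show ?thesis by (simp add: sum_distrib_left)
  qed
  have collapse: "(\<Sum>i\<in>S. \<Sum>j\<in>S. x i * x j * h i j) = (\<Sum>i\<in>S. (x i)\<^sup>2 * h i i)"
    if "\<And>i j. i \<in> S \<Longrightarrow> j \<in> S \<Longrightarrow> i \<noteq> j \<Longrightarrow> h i j = 0" for h :: "nat \<Rightarrow> nat \<Rightarrow> real"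
  proof (rule sum.cong[OF refl])
    fix i assume i: "i \<in> S"
    have "(\<Sum>j\<in>S. x i * x j * h i j) = (\<Sum>j\<in>S. if j = i then (x i)\<^sup>2 * h i i else 0)"
      using that i by (intro sum.cong refl) (auto simp: power2_eq_square)
    then show "(\<Sum>j\<in>S. x i * x j * h i j) = (x i)\<^sup>2 * h i i" using i fin by simp
  qed
  have norm: "(\<Sum>l<n. (y l)\<^sup>2) = (\<Sum>i\<in>S. (x i)\<^sup>2)"
  proof -
    have "(\<Sum>l<n. (y l)\<^sup>2) = (\<Sum>i\<in>S. \<Sum>j\<in>S. x i * x j * (\<Sum>l<n. P i l * P j l))"
      using quad[of "\<lambda>_. 1"] by simp
    also have "\<dots> = (\<Sum>i\<in>S. (x i)\<^sup>2 * (\<Sum>l<n. P i l * P i l))"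
      using S by (intro collapse) (auto simp: orth subset_iff)
    also have "\<dots> = (\<Sum>i\<in>S. (x i)\<^sup>2)"
      using S by (intro sum.cong refl) (auto simp: orth subset_iff)
    finally show ?thesis .
  qed
  have "(\<Sum>i\<in>S. (x i)\<^sup>2) > 0" using x fin by (intro sum_pos2[of S j]) auto
  then have "\<exists>l<n. y l \<noteq> 0" unfolding norm[symmetric] by (force intro: ccontr)
  then obtain m where m: "m < n" "y m \<noteq> 0" by blast
  have le: "q l * (y l)\<^sup>2 \<le> w * (y l)\<^sup>2" if "l < n" for l
    using zero[of l] that by (cases "q l \<ge> w") (auto simp: y_def intro: mult_right_mono)
  \<comment> \<open>The coordinates of \<open>y\<close> vanish wherever \<open>q l \<ge> w\<close>,
    so a nonzero coordinate lies at a small eigenvalue. This makes the comparison of sums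
    strict.\<close>
  have "q m < w" using zero[of m] m by (force simp: y_def)
  then have "q m * (y m)\<^sup>2 < w * (y m)\<^sup>2" using m by simp
  then have "(\<Sum>l<n. q l * (y l)\<^sup>2) < (\<Sum>l<n. w * (y l)\<^sup>2)"
    using m(1) le by (intro sum_strict_mono_ex1) auto
  also have "\<dots> = (\<Sum>i\<in>S. (x i)\<^sup>2 * w)"
    by (simp add: sum_distrib_left[symmetric] norm sum_distrib_right[symmetric] mult.commute)
  also have "\<dots> \<le> (\<Sum>i\<in>S. (x i)\<^sup>2 * (\<Sum>l<n. P i l * q l * P i l))"
    using diag by (intro sum_mono mult_left_mono) auto
  also have "\<dots> = (\<Sum>l<n. q l * (y l)\<^sup>2)"
    unfolding quad using off by (intro collapse[symmetric]) auto
  finally show False by simp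
qed

text \<open>An orthogonal diagonalisation reduces both claims to the preceding bound: the first uses
  the values \<open>poly p (d l)\<close> and threshold \<open>w\<close>, the second their negatives
  and \<open>- w\<close>.\<close>

lemma card_diagonal_block_le_card_eigenvalues:
  fixes A :: "real mat"
  assumes A: "A \<in> carrier_mat n n" and sym: "A\<^sup>T = A" and S: "S \<subseteq> {..<n}"
    and off: "\<And>i j. i \<in> S \<Longrightarrow> j \<in> S \<Longrightarrow> i \<noteq> j \<Longrightarrow> poly_mat p A $$ (i, j) = 0"
  shows "(\<And>i. i \<in> S \<Longrightarrow> w \<le> poly_mat p A $$ (i, i)) \<Longrightarrow>
      card S \<le> card {i \<in> {1..n}. poly p (eigenvalue_list A ! (i - 1)) \<ge> w}"
    and "(\<And>i. i \<in> S \<Longrightarrow> poly_mat p A $$ (i, i) \<le> w) \<Longrightarrow>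
      card S \<le> card {i \<in> {1..n}. poly p (eigenvalue_list A ! (i - 1)) \<le> w}"
proof -
  obtain P d where sim: "similar_mat_wit A (mat_diag n d) P P\<^sup>T"
    using real_symmetric_orthogonally_diagonalizable[OF A sym] by blast
  have P: "P \<in> carrier_mat n n" "P * P\<^sup>T = 1\<^sub>m n" using similar_mat_witD2[OF A sim] by auto
  have orth: "(\<Sum>l<n. P $$ (i, l) * P $$ (j, l)) = (if i = j then 1 else 0)"
    if "i < n" "j < n" for i j
    using arg_cong[OF P(2), of "\<lambda>M. M $$ (i, j)"] P(1) that
    by (simp add: scalar_prod_def atLeast0LessThan)
  note index = poly_mat_index_of_diagonalization[OF A sim]
  have off': "(\<Sum>l<n. P $$ (i, l) * poly p (d l) * P $$ (j, l)) = 0" if "i \<in> S" "j \<in> S" "i \<noteq> j" for i j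
    using off[OF that] index[of i j p] S that by auto
  { assume ge: "\<And>i. i \<in> S \<Longrightarrow> w \<le> poly_mat p A $$ (i, i)"
    have "card S \<le> card {l \<in> {..<n}. poly p (d l) \<ge> w}"
    proof (rule card_diagonal_block_le_card_large_eigenvalues[OF orth S off'])
      show "w \<le> (\<Sum>l<n. P $$ (i, l) * poly p (d l) * P $$ (i, l))" if "i \<in> S" for i
        using ge[OF that] index[of i i p] S that by auto
    qed
    then show "card S \<le> card {i \<in> {1..n}. poly p (eigenvalue_list A ! (i - 1)) \<ge> w}"
      using card_eigenvalue_list_indices[OF A sim, of "\<lambda>z. poly p z \<ge> w"] by simp }
  { assume le: "\<And>i. i \<in> S \<Longrightarrow> poly_mat p A $$ (i, i) \<le> w"
    have "card S \<le> card {l \<in> {..<n}. - poly p (d l) \<ge> - w}"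
    proof (rule card_diagonal_block_le_card_large_eigenvalues[OF orth S])
      show "(\<Sum>l<n. P $$ (i, l) * - poly p (d l) * P $$ (j, l)) = 0"
        if "i \<in> S" "j \<in> S" "i \<noteq> j" for i j
        using off'[OF that] by (simp add: sum_negf)
      show "- w \<le> (\<Sum>l<n. P $$ (i, l) * - poly p (d l) * P $$ (i, l))" if "i \<in> S" for i
        using le[OF that] index[of i i p] S that by (auto simp: sum_negf)
    qed
    then show "card S \<le> card {i \<in> {1..n}. poly p (eigenvalue_list A ! (i - 1)) \<le> w}"
      using card_eigenvalue_list_indices[OF A sim, of "\<lambda>z. poly p z \<le> w"] by simp }
qed

section \<open>Paths and powers of the adjacency matrix\<close>

text \<open>Paths may not repeat vertices. If \<open>w\<close> already lies on the path, cutting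
  there gives a path to \<open>w\<close>; otherwise \<open>w\<close> is appended.\<close>

lemma is_path_extend:
  assumes path: "is_path V E u xs v" and edge: "{v, w} \<in> E" and w: "w \<in> V"
  obtains ys where "is_path V E u ys w" "length ys \<le> Suc (length xs)"
proof (cases "w \<in> set xs")
  case True
  then obtain as bs where xs: "xs = as @ w # bs" by (meson split_list)
  have "is_path V E u (as @ [w]) w"
    unfolding is_path_def
  proof (intro conjI allI impI)
    show "hd (as @ [w]) = u" using path by (cases as) (auto simp: is_path_def xs)
    fix i assume i: "Suc i < length (as @ [w])"
    have nth: "(as @ [w]) ! k = xs ! k" if "k < length (as @ [w])" for k
      using that by (auto simp: xs nth_append)
    have "{xs ! i, xs ! Suc i} \<in> E"
      using path i unfolding is_path_def by (auto simp: xs)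
    then show "{(as @ [w]) ! i, (as @ [w]) ! Suc i} \<in> E" using nth i by simp
  qed (use path in \<open>auto simp: is_path_def xs\<close>)
  then show ?thesis using that by (simp add: xs)
next
  case False
  have "is_path V E u (xs @ [w]) w"
    unfolding is_path_def
  proof (intro conjI allI impI)
    fix i assume i: "Suc i < length (xs @ [w])"
    show "{(xs @ [w]) ! i, (xs @ [w]) ! Suc i} \<in> E"
    proof (cases "Suc i < length xs")
      case True
      then show ?thesis using path by (simp add: is_path_def nth_append)
    next
      case False
      then have "i = length xs - 1" "Suc i = length xs" using i by auto
      moreover have "xs ! (length xs - 1) = v"
        using path by (auto simp: is_path_def last_conv_nth)
      ultimately show ?thesis using edge by (simp add: nth_append)
    qed
  qed (use path False w in \<open>auto simp: is_path_def\<close>)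
  then show ?thesis using that by simp
qed

lemma adjacency_matrix_carrier: "adjacency_matrix vs E \<in> carrier_mat (length vs) (length vs)"
  by (simp add: adjacency_matrix_def)

text \<open>A nonzero entry of a product has a nonzero summand, which supplies the last step of a
  walk. Removing repetitions may shorten the walk, so only an upper bound survives;
  \<open>Suc k\<close> counts the vertices of \<open>k\<close> steps.\<close>

lemma path_of_adjacency_matrix_pow_nonzero:
  assumes "i < length vs" "j < length vs" "(adjacency_matrix vs E ^\<^sub>m k) $$ (i, j) \<noteq> 0"
  shows "\<exists>xs. is_path (set vs) E (vs ! i) xs (vs ! j) \<and> length xs \<le> Suc k"
  using assms
proof (induction k arbitrary: j)
  case 0
  then have "i = j" by (auto simp: adjacency_matrix_def split: if_splits)
  then have "is_path (set vs) E (vs ! i) [vs ! i] (vs ! j)"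
    using 0 by (simp add: is_path_def)
  then show ?case by force
next
  case (Suc k)
  let ?A = "adjacency_matrix vs E" and ?n = "length vs"
  note A = adjacency_matrix_carrier[of vs E]
  have "(?A ^\<^sub>m Suc k) $$ (i, j) = (\<Sum>l<?n. (?A ^\<^sub>m k) $$ (i, l) * ?A $$ (l, j))"
    using Suc.prems A by (simp add: scalar_prod_def atLeast0LessThan)
  then obtain l where l: "l < ?n" "(?A ^\<^sub>m k) $$ (i, l) \<noteq> 0" "?A $$ (l, j) \<noteq> 0"
    using Suc.prems(3) by (metis (no_types, lifting) lessThan_iff mult_eq_0_iff sum.neutral)
  then obtain xs where xs: "is_path (set vs) E (vs ! i) xs (vs ! l)" "length xs \<le> Suc k"
    using Suc.IH Suc.prems(1) by blast
  have "{vs ! l, vs ! j} \<in> E"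
    using l Suc.prems by (auto simp: adjacency_matrix_def split: if_splits)
  then show ?case
    using is_path_extend[OF xs(1)] xs(2) Suc.prems(2) by (metis Suc_le_mono le_trans nth_mem)
qed

text \<open>Every power occurring in \<open>p\<close> has exponent at most \<open>t\<close>, so a
  nonzero entry of it would provide a path with at most \<open>t\<close> edges. Infinite distance is
  included in \<open>far\<close>.\<close>

lemma poly_mat_adjacency_eq_0:
  assumes "i < length vs" "j < length vs" "degree p \<le> t"
    and far: "\<not> graph_dist (set vs) E (vs ! i) (vs ! j) \<le> enat t"
  shows "poly_mat p (adjacency_matrix vs E) $$ (i, j) = 0"
proof -
  have "(adjacency_matrix vs E ^\<^sub>m k) $$ (i, j) = 0" if "k \<le> degree p" for k
  proof (rule ccontr)
    assume "(adjacency_matrix vs E ^\<^sub>m k) $$ (i, j) \<noteq> 0"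
    then obtain xs where xs: "is_path (set vs) E (vs ! i) xs (vs ! j)" "length xs \<le> Suc k"
      using path_of_adjacency_matrix_pow_nonzero assms by blast
    then have "graph_dist (set vs) E (vs ! i) (vs ! j) \<le> enat (length xs - 1)"
      unfolding graph_dist_def by (intro INF_lower) simp
    also have "\<dots> \<le> enat t" using xs(2) that assms(3) by simp
    finally show False using far by simp
  qed
  then show ?thesis
    using assms(1,2) by (simp add: poly_mat_def adjacency_matrix_def)
qed

lemma adjacency_matrix_sym: "(adjacency_matrix vs E)\<^sup>T = adjacency_matrix vs E"
  by (rule eq_matI) (auto simp: adjacency_matrix_def insert_commute)

section \<open>Colour classes and the lower bound\<close>

text \<open>The \<open>LEAST\<close> is attained once some number of colours suffices; an injective
  numbering of \<open>E\<close> shows that \<open>card E\<close> does.\<close>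

lemma distance_chromatic_index_colouring:
  assumes "finite E"
  obtains c :: "'a set \<Rightarrow> nat"
  where "c ` E \<subseteq> {..<distance_chromatic_index E t}" "distance_edge_colouring E t c"
proof -
  obtain f :: "'a set \<Rightarrow> nat" where f: "f ` E = {i. i < card E}" "inj_on f E"
    using finite_imp_inj_to_nat_seg[OF assms] card_image by (metis card_Collect_less_nat)
  have "\<exists>c :: 'a set \<Rightarrow> nat. c ` E \<subseteq> {..<card E} \<and> distance_edge_colouring E t c"
    using f by (intro exI[of _ f]) (auto simp: distance_edge_colouring_def inj_on_def)
  from LeastI[of "\<lambda>k. \<exists>c :: 'a set \<Rightarrow> nat. c ` E \<subseteq> {..<k} \<and> distance_edge_colouring E t c", OF this]
  show ?thesis using that unfolding distance_chromatic_index_def by blast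
qed

theorem theorem3p1:
  fixes V :: "'a set" and E :: "'a set set" and es :: "'a set list"
    and t :: nat and p :: "real poly"
    and A' :: "real mat" and ev :: "nat \<Rightarrow> real" and W' w' :: real
  assumes graph: "simple_graph V E"
    and nonempty: "E \<noteq> {}"
    and t: "t \<ge> 1"
    and enum: "distinct es" "set es = E"
    and degree: "degree p \<le> t"
  defines "A' \<equiv> adjacency_matrix es (line_edges E)"
    and "ev \<equiv> (\<lambda>i. eigenvalue_list A' ! (i - 1))"
    and "W' \<equiv> max_diag (poly_mat p A')"
    and "w' \<equiv> min_diag (poly_mat p A')"
  shows "real (distance_chromatic_index E t) \<ge>
    real (card E) /
    real (min (card {i \<in> {1..card E}. poly p (ev i) \<ge> w'})
              (card {i \<in> {1..card E}. poly p (ev i) \<le> W'}))"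
proof -
  define n where "n = card E"
  have n: "length es = n" using enum distinct_card n_def by metis
  have A: "A' \<in> carrier_mat n n" and sym: "A'\<^sup>T = A'"
    using adjacency_matrix_carrier[of es] adjacency_matrix_sym by (simp_all add: A'_def n)
  have fin: "finite E" using enum by auto
  define N where "N = min (card {i \<in> {1..card E}. poly p (ev i) \<ge> w'})
      (card {i \<in> {1..card E}. poly p (ev i) \<le> W'})"
  obtain c :: "'a set \<Rightarrow> nat" where c: "c ` E \<subseteq> {..<distance_chromatic_index E t}"
    and col: "distance_edge_colouring E t c"
    using distance_chromatic_index_colouring[OF fin] by blast
  have dim: "dim_row (poly_mat p A') = n" using A by (simp add: poly_mat_def)
  have bounds: "w' \<le> poly_mat p A' $$ (i, i)" "poly_mat p A' $$ (i, i) \<le> W'" if "i < n" for i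
    unfolding w'_def W'_def min_diag_def max_diag_def
    using that by (auto intro!: Min_le Max_ge simp: dim)
  have class_le: "card {e \<in> E. c e = k} \<le> N" for k
  proof -
    \<comment> \<open>The colour class is replaced by its positions in \<open>es\<close>, because
      these index the rows and columns of \<open>A'\<close>.\<close>
    define S where "S = {i. i < n \<and> c (es ! i) = k}"
    have S: "S \<subseteq> {..<n}" by (auto simp: S_def)
    have "{e \<in> E. c e = k} = (!) es ` S"
      unfolding S_def enum(2)[symmetric] by (auto simp: in_set_conv_nth n)
    moreover have "inj_on ((!) es) S"
      using enum(1) n by (auto simp: inj_on_def S_def nth_eq_iff_index_eq)
    ultimately have card: "card {e \<in> E. c e = k} = card S" by (simp add: card_image)
    have off: "poly_mat p A' $$ (i, j) = 0" if ij: "i \<in> S" "j \<in> S" "i \<noteq> j" for i j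
      unfolding A'_def
    proof (rule poly_mat_adjacency_eq_0[OF _ _ degree])
      have "es ! i \<in> E" "es ! j \<in> E" "es ! i \<noteq> es ! j" "c (es ! i) = c (es ! j)"
        using ij enum n by (auto simp: S_def nth_eq_iff_index_eq)
      then show "\<not> graph_dist (set es) (line_edges E) (es ! i) (es ! j) \<le> enat t"
        using col unfolding distance_edge_colouring_def edge_dist_def enum(2) by blast
    qed (use ij n in \<open>auto simp: S_def\<close>)
    have "card S \<le> card {i \<in> {1..card E}. poly p (ev i) \<ge> w'}"
      unfolding ev_def n_def[symmetric]
      by (rule card_diagonal_block_le_card_eigenvalues(1)[OF A sym S off])
        (use bounds S in auto)
    moreover have "card S \<le> card {i \<in> {1..card E}. poly p (ev i) \<le> W'}"
      unfolding ev_def n_def[symmetric]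
      by (rule card_diagonal_block_le_card_eigenvalues(2)[OF A sym S off])
        (use bounds S in auto)
    ultimately show ?thesis by (simp add: card N_def)
  qed
  let ?k = "distance_chromatic_index E t"
  \<comment> \<open>The colour classes cover \<open>E\<close>, and each has at most \<open>N\<close>
    elements.\<close>
  have "E = (\<Union>k<?k. {e \<in> E. c e = k})" using c by auto
  then have "card E = card (\<Union>k<?k. {e \<in> E. c e = k})"
    by (rule arg_cong)
  also have "\<dots> \<le> (\<Sum>k<?k. card {e \<in> E. c e = k})"
    by (rule card_UN_le) simp
  also have "\<dots> \<le> ?k * N"
    using sum_bounded_above[of "{..<?k}" "\<lambda>k. card {e \<in> E. c e = k}" N] class_le by simp
  finally have "real (card E) \<le> real ?k * real N"
    by (metis of_nat_le_iff of_nat_mult)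
  \<comment> \<open>In the case \<open>N = 0\<close> the quotient is 0 by the convention for
    division.\<close>
  then have "real (card E) / real N \<le> real ?k"
    by (cases "N = 0") (auto simp: field_simps)
  then show ?thesis unfolding N_def .
qed


end
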